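(* Let $(X,\mu,\mathcal{E},\mathcal{F})$ be a Dirichlet space whose heat kernel satisfies $p_t(x,y)\le C_ht^{-\beta}$ for $\mu\times\mu$-a.e. $(x,y)\in X\times X$ and every $t>0$, for some constants $C_h>0$ and $\beta>0$. Assume that, for some $p\ge1$, condition $(\mathrm{PPI}_p)$ is satisfied, with constant $C_p$: for every $t\ge0$ and every $f\in W^{1,p}(\mathcal{E})$ (or $f\in BV(\mathcal{E})$ if $p=1$), $$\|P_tf-f\|_{L^p(X,\mu)}\le C_p\,t^{\alpha_p}\,\mathbf{Var}_{p,\mathcal{E}}(f).$$ Then there exists a constant $c_p>0$ such that for every $f\in W^{1,p}(\mathcal{E})$ (or $f\in BV(\mathcal{E})$ if $p=1$), $$\|f\|_{L^q(X,\mu)}\le c_p\,C_p^{\frac{\beta}{\beta+\alpha_p}}\,C_h^{\frac{\alpha_p}{\beta+\alpha_p}}\,\mathbf{Var}_{p,\mathcal{E}}(f)^{\frac{\beta}{\beta+\alpha_p}}\,\|f\|_{L^1(X,\mu)}^{\frac{\alpha_p}{\beta+\alpha_p}},$$ where $q=p\big(1+\frac{\alpha_p}{\beta}\big)$.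
   Context: $X$ is a good measurable space (like a Polish or Radon space) with a $\sigma$-finite measure $\mu$ supported on $X$, and $(\mathcal{E},\mathcal{F})$, $\mathcal{F}=\mathrm{dom}\,\mathcal{E}$, is a Dirichlet form on $L^2(X,\mu)$. Its heat semigroup $\{P_t\}_{t\ge0}$, extended to all $L^p(X,\mu)$, $1\le p\le\infty$, is assumed conservative ($P_t1=1$), and it admits a measurable heat kernel $p_t(x,y)$. For $p\ge1$, $\alpha\ge0$ (with $P_t(|f-f(y)|^p)(y)$ meaning $P_t$ applied to $x\mapsto|f(x)-f(y)|^p$, evaluated at $y$), $$\mathbf{B}^{p,\alpha}(X)=\Big\{f\in L^p(X,\mu):\limsup_{t\to0^+}t^{-\alpha}\Big(\int_XP_t(|f-f(y)|^p)(y)\,d\mu(y)\Big)^{1/p}<\infty\Big\}.$$ Set $\alpha_p=\sup\{\alpha>0:\mathbf{B}^{p,\alpha}(X)\text{ contains non a.e. constant functions}\}$ (understood to be a finite positive number), $W^{1,p}(\mathcal{E})=\mathbf{B}^{p,\alpha_p}(X)$ for $p>1$, $BV(\mathcal{E})=\mathbf{B}^{1,\alpha_1}(X)$, and for $f$ in these classes $$\mathbf{Var}_{p,\mathcal{E}}(f)=\liminf_{t\to0^+}t^{-\alpha_p}\Big(\int_XP_t(|f-f(y)|^p)(y)\,d\mu(y)\Big)^{1/p}.$$ *)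

theory Defs
  imports "HOL-Analysis.Analysis"
begin

section \<open>Lebesgue spaces\<close>

text \<open>
  Elements of \<open>L\<^sup>p\<close> are represented by everywhere defined real-valued functions; statements
  that in the literature concern equivalence classes hold almost everywhere.
\<close>

definition Lp :: "'a measure \<Rightarrow> real \<Rightarrow> ('a \<Rightarrow> real) set" where
  "Lp M p = {f \<in> borel_measurable M. integrable M (\<lambda>x. \<bar>f x\<bar> powr p)}"

definition Linf :: "'a measure \<Rightarrow> ('a \<Rightarrow> real) set" where
  "Linf M = {f \<in> borel_measurable M. \<exists>c. AE x in M. \<bar>f x\<bar> \<le> c}"

text \<open>Powers of extended nonnegative reals, with \<open>\<infinity> ^ a = \<infinity>\<close>; only used for \<open>a > 0\<close>.\<close>

definition epowr :: "ennreal \<Rightarrow> real \<Rightarrow> ennreal" where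
  "epowr x a = (if x = \<infinity> then \<infinity> else ennreal (enn2real x powr a))"

definition Lp_norm :: "'a measure \<Rightarrow> real \<Rightarrow> ('a \<Rightarrow> real) \<Rightarrow> ennreal" where
  "Lp_norm M p f = epowr (\<integral>\<^sup>+x. ennreal (\<bar>f x\<bar> powr p) \<partial>M) (1 / p)"


section \<open>Dirichlet forms\<close>

text \<open>
  A densely defined, symmetric, nonnegative, closed and Markovian bilinear form \<open>E\<close> with domain
  \<open>F\<close> on \<open>L\<^sup>2\<close>. No topology on the underlying space is used: \<open>M\<close> is an arbitrary
  \<open>\<sigma>\<close>-finite measure space, which covers Polish and Radon spaces.
  The assumption \<open>dom_AE\<close> says that \<open>F\<close> and \<open>E\<close> are well defined on
  equivalence classes modulo null sets, and \<open>closed\<close> that \<open>F\<close> is complete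
  for the norm \<open>(E f f + \<parallel>f\<parallel>\<^sup>2)\<close> to the power \<open>1/2\<close>.
\<close>

locale dirichlet_form = sigma_finite_measure M
  for M :: "'a measure" +
  fixes E :: "('a \<Rightarrow> real) \<Rightarrow> ('a \<Rightarrow> real) \<Rightarrow> real"
    and F :: "('a \<Rightarrow> real) set"
  assumes dom_subset: "F \<subseteq> Lp M 2"
    and dom_AE: "\<lbrakk>f \<in> F; g \<in> borel_measurable M; AE x in M. f x = g x\<rbrakk>
          \<Longrightarrow> g \<in> F \<and> (\<forall>h\<in>F. E g h = E f h)"
    and dom_zero: "(\<lambda>x. 0) \<in> F"
    and dom_add: "\<lbrakk>f \<in> F; g \<in> F\<rbrakk> \<Longrightarrow> (\<lambda>x. f x + g x) \<in> F"
    and dom_scale: "f \<in> F \<Longrightarrow> (\<lambda>x. c * f x) \<in> F"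
    and dense: "\<lbrakk>f \<in> Lp M 2; e > 0\<rbrakk> \<Longrightarrow> \<exists>g\<in>F. Lp_norm M 2 (\<lambda>x. f x - g x) < e"
    and sym: "\<lbrakk>f \<in> F; g \<in> F\<rbrakk> \<Longrightarrow> E f g = E g f"
    and add: "\<lbrakk>f \<in> F; g \<in> F; h \<in> F\<rbrakk> \<Longrightarrow> E (\<lambda>x. f x + g x) h = E f h + E g h"
    and scale: "\<lbrakk>f \<in> F; h \<in> F\<rbrakk> \<Longrightarrow> E (\<lambda>x. c * f x) h = c * E f h"
    and nonneg: "f \<in> F \<Longrightarrow> 0 \<le> E f f"
    and closed: "\<lbrakk>\<And>n. u n \<in> F;
          \<And>e. e > 0 \<Longrightarrow> \<exists>N. \<forall>m\<ge>N. \<forall>n\<ge>N.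
            E (\<lambda>x. u m x - u n x) (\<lambda>x. u m x - u n x) + (LINT x|M. (u m x - u n x)\<^sup>2) < e\<rbrakk>
          \<Longrightarrow> \<exists>f\<in>F. (\<lambda>n. E (\<lambda>x. u n x - f x) (\<lambda>x. u n x - f x)
                          + (LINT x|M. (u n x - f x)\<^sup>2)) \<longlonglongrightarrow> 0"
    and markov: "f \<in> F \<Longrightarrow> (\<lambda>x. min (max (f x) 0) 1) \<in> F
          \<and> E (\<lambda>x. min (max (f x) 0) 1) (\<lambda>x. min (max (f x) 0) 1) \<le> E f f"


section \<open>Heat semigroup and heat kernel\<close>

text \<open>
  \<open>P\<close> is the strongly continuous contraction semigroup on \<open>L\<^sup>2\<close> generated by the operator
  \<open>L\<close> of the form, where \<open>f \<in> dom L\<close> and \<open>L f = h\<close> iff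
  \<open>f \<in> F\<close> and \<open>E f g = - \<langle>h, g\<rangle>\<close> for all \<open>g \<in> F\<close>.
\<close>

definition heat_semigroup ::
  "'a measure \<Rightarrow> (('a \<Rightarrow> real) \<Rightarrow> ('a \<Rightarrow> real) \<Rightarrow> real) \<Rightarrow> ('a \<Rightarrow> real) set
    \<Rightarrow> (real \<Rightarrow> ('a \<Rightarrow> real) \<Rightarrow> 'a \<Rightarrow> real) \<Rightarrow> bool" where
  "heat_semigroup M E F P \<longleftrightarrow>
     (\<forall>t\<ge>0. \<forall>f\<in>Lp M 2. P t f \<in> Lp M 2 \<and> Lp_norm M 2 (P t f) \<le> Lp_norm M 2 f) \<and>
     (\<forall>t\<ge>0. \<forall>f\<in>Lp M 2. \<forall>g\<in>Lp M 2. \<forall>a b.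
        AE x in M. P t (\<lambda>y. a * f y + b * g y) x = a * P t f x + b * P t g x) \<and>
     (\<forall>f\<in>Lp M 2. AE x in M. P 0 f x = f x) \<and>
     (\<forall>s\<ge>0. \<forall>t\<ge>0. \<forall>f\<in>Lp M 2. AE x in M. P (s + t) f x = P s (P t f) x) \<and>
     (\<forall>f\<in>Lp M 2. ((\<lambda>t. Lp_norm M 2 (\<lambda>x. P t f x - f x)) \<longlongrightarrow> 0) (at_right 0)) \<and>
     (\<forall>f\<in>Lp M 2. \<forall>h\<in>Lp M 2.
        ((\<lambda>t. Lp_norm M 2 (\<lambda>x. (P t f x - f x) / t - h x)) \<longlongrightarrow> 0) (at_right 0) \<longleftrightarrow>
        f \<in> F \<and> (\<forall>g\<in>F. E f g = - (LINT x|M. h x * g x)))"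

text \<open>
  \<open>P\<close> is extended from \<open>L\<^sup>2\<close> to all \<open>L\<^sup>r\<close>: for \<open>1 \<le> r < \<infinity>\<close> as a linear contraction, which
  determines it by density of the intersection with \<open>L\<^sup>2\<close>, and for \<open>r = \<infinity>\<close> by duality with
  \<open>L\<^sup>1\<close>.
\<close>

definition Lp_extended :: "'a measure \<Rightarrow> (real \<Rightarrow> ('a \<Rightarrow> real) \<Rightarrow> 'a \<Rightarrow> real) \<Rightarrow> bool" where
  "Lp_extended M P \<longleftrightarrow>
     (\<forall>t\<ge>0. \<forall>r\<ge>1. \<forall>f\<in>Lp M r. P t f \<in> Lp M r \<and> Lp_norm M r (P t f) \<le> Lp_norm M r f) \<and>
     (\<forall>t\<ge>0. \<forall>r\<ge>1. \<forall>f\<in>Lp M r. \<forall>g\<in>Lp M r. \<forall>a b.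
        AE x in M. P t (\<lambda>y. a * f y + b * g y) x = a * P t f x + b * P t g x) \<and>
     (\<forall>t\<ge>0. \<forall>f\<in>Linf M. P t f \<in> Linf M \<and>
        (\<forall>g\<in>Lp M 1. (LINT x|M. P t f x * g x) = (LINT x|M. f x * P t g x)))"

definition conservative :: "'a measure \<Rightarrow> (real \<Rightarrow> ('a \<Rightarrow> real) \<Rightarrow> 'a \<Rightarrow> real) \<Rightarrow> bool" where
  "conservative M P \<longleftrightarrow> (\<forall>t\<ge>0. AE x in M. P t (\<lambda>_. 1) x = 1)"

definition heat_kernel ::
  "'a measure \<Rightarrow> (real \<Rightarrow> ('a \<Rightarrow> real) \<Rightarrow> 'a \<Rightarrow> real) \<Rightarrow> (real \<Rightarrow> 'a \<Rightarrow> 'a \<Rightarrow> real) \<Rightarrow> bool" where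
  "heat_kernel M P k \<longleftrightarrow>
     (\<forall>t>0. (\<lambda>(x, y). k t x y) \<in> borel_measurable (M \<Otimes>\<^sub>M M)) \<and>
     (\<forall>t>0. \<forall>x\<in>space M. \<forall>y\<in>space M. 0 \<le> k t x y) \<and>
     (\<forall>t>0. \<forall>f \<in> Linf M \<union> (\<Union>r\<in>{1..}. Lp M r).
        AE x in M. integrable M (\<lambda>y. k t x y * f y) \<and> P t f x = (LINT y|M. k t x y * f y))"

locale dirichlet_space = dirichlet_form M E F
  for M :: "'a measure" and E F +
  fixes P :: "real \<Rightarrow> ('a \<Rightarrow> real) \<Rightarrow> 'a \<Rightarrow> real"
    and k :: "real \<Rightarrow> 'a \<Rightarrow> 'a \<Rightarrow> real"
  assumes semigroup: "heat_semigroup M E F P"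
    and extended: "Lp_extended M P"
    and conservative: "conservative M P"
    and kernel: "heat_kernel M P k"


section \<open>Heat semigroup based Besov classes\<close>

text \<open>
  The integral of \<open>P\<^sub>t(|f - f(y)|\<^sup>p)(y)\<close> over \<open>y\<close>, to the power \<open>1/p\<close>. Evaluating at the point
  \<open>y\<close> a function that itself depends on \<open>y\<close> (and need not lie in any \<open>L\<^sup>r\<close>) requires
  a pointwise version of \<open>P\<^sub>t\<close>; this is the one given by the heat kernel,
  with values in \<open>[0, \<infinity>]\<close>.
\<close>

definition heat_osc ::
  "'a measure \<Rightarrow> (real \<Rightarrow> 'a \<Rightarrow> 'a \<Rightarrow> real) \<Rightarrow> real \<Rightarrow> real \<Rightarrow> ('a \<Rightarrow> real) \<Rightarrow> ennreal" where
  "heat_osc M k p t f =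
     epowr (\<integral>\<^sup>+y. (\<integral>\<^sup>+x. ennreal (k t y x * \<bar>f x - f y\<bar> powr p) \<partial>M) \<partial>M) (1 / p)"

definition besov ::
  "'a measure \<Rightarrow> (real \<Rightarrow> 'a \<Rightarrow> 'a \<Rightarrow> real) \<Rightarrow> real \<Rightarrow> real \<Rightarrow> ('a \<Rightarrow> real) set" where
  "besov M k p \<alpha> =
     {f \<in> Lp M p. Limsup (at_right 0) (\<lambda>t. ennreal (t powr - \<alpha>) * heat_osc M k p t f) < \<infinity>}"

definition crit_exp :: "'a measure \<Rightarrow> (real \<Rightarrow> 'a \<Rightarrow> 'a \<Rightarrow> real) \<Rightarrow> real \<Rightarrow> ereal" where
  "crit_exp M k p =
     Sup (ereal ` {\<alpha>. 0 < \<alpha> \<and> (\<exists>f\<in>besov M k p \<alpha>. \<not> (\<exists>c. AE x in M. f x = c))})"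

text \<open>The critical exponent as a real number; meaningful only if \<open>crit_exp\<close> is finite.\<close>

definition crit_alpha :: "'a measure \<Rightarrow> (real \<Rightarrow> 'a \<Rightarrow> 'a \<Rightarrow> real) \<Rightarrow> real \<Rightarrow> real" where
  "crit_alpha M k p = real_of_ereal (crit_exp M k p)"

text \<open>The space \<open>W\<close> of order \<open>(1, p)\<close> if \<open>p > 1\<close>, and the space \<open>BV\<close> if \<open>p = 1\<close>.\<close>

definition sobolev :: "'a measure \<Rightarrow> (real \<Rightarrow> 'a \<Rightarrow> 'a \<Rightarrow> real) \<Rightarrow> real \<Rightarrow> ('a \<Rightarrow> real) set" where
  "sobolev M k p = besov M k p (crit_alpha M k p)"

definition Var ::
  "'a measure \<Rightarrow> (real \<Rightarrow> 'a \<Rightarrow> 'a \<Rightarrow> real) \<Rightarrow> real \<Rightarrow> ('a \<Rightarrow> real) \<Rightarrow> ennreal" where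
  "Var M k p f =
     Liminf (at_right 0) (\<lambda>t. ennreal (t powr - crit_alpha M k p) * heat_osc M k p t f)"

definition PPI ::
  "'a measure \<Rightarrow> (real \<Rightarrow> ('a \<Rightarrow> real) \<Rightarrow> 'a \<Rightarrow> real) \<Rightarrow> (real \<Rightarrow> 'a \<Rightarrow> 'a \<Rightarrow> real)
    \<Rightarrow> real \<Rightarrow> real \<Rightarrow> bool" where
  "PPI M P k p C \<longleftrightarrow>
     (\<forall>t\<ge>0. \<forall>f\<in>sobolev M k p.
        Lp_norm M p (\<lambda>x. P t f x - f x) \<le> ennreal (C * t powr crit_alpha M k p) * Var M k p f)"

end

theory Submission
  imports Defs "HOL-Library.Nat_Bijection"
begin

text \<open>
  The proof follows the method of Bakry, Coulhon, Ledoux and Saloff-Coste: a weak-type estimate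
  is strengthened to a norm estimate by applying it to the slices of the function between
  consecutive powers of two.

  Weak type. The kernel bound makes the semigroup ultracontractive,
  \<open>\<bar>P\<^sub>t g\<bar> \<le> C\<^sub>h t\<^sup>-\<^sup>\<beta> \<parallel>g\<parallel>\<^sub>1\<close>. For a level \<open>s\<close> take the time \<open>t\<close> at which the right-hand
  side is \<open>s / 2\<close>. Where \<open>\<bar>g\<bar> \<ge> s\<close> one then has \<open>\<bar>P\<^sub>t g - g\<bar> \<ge> s / 2\<close>, so Markov's inequality and the
  Poincare type inequality for \<open>P\<^sub>t g - g\<close> bound the measure of that set by a multiple of
  \<open>s\<^sup>-\<^sup>p (t\<^sup>\<alpha> C\<^sub>p Var g)\<^sup>p\<close>. Inserting \<open>t\<close> turns the power of \<open>s\<close> into exactly \<open>s\<^sup>-\<^sup>q\<close>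
  (\<open>level_set_estimate\<close>).

  Strong type. Let \<open>f\<^sub>j\<close> be the part of \<open>\<bar>f\<bar>\<close> between the heights \<open>2\<^sup>j\<close> and \<open>2\<^sup>j\<^sup>+\<^sup>1\<close>.
  It equals \<open>2\<^sup>j\<close> where \<open>\<bar>f\<bar> \<ge> 2\<^sup>j\<^sup>+\<^sup>1\<close>, so the weak estimate for \<open>f\<^sub>j\<close> at the level \<open>2\<^sup>j\<close> controls
  \<open>2\<^sup>j\<^sup>q \<mu>(\<bar>f\<bar> \<ge> 2\<^sup>j\<^sup>+\<^sup>1)\<close> by \<open>Var(f\<^sub>j)\<^sup>p\<close>, and up to a constant factor
  the sum of these quantities over \<open>j\<close> dominates \<open>\<integral> \<bar>f\<bar>\<^sup>q\<close>. The sum on the other side does not lose anything because of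
  \<open>\<Sum>\<^sub>j Var(f\<^sub>j)\<^sup>p \<le> Var(f)\<^sup>p\<close> (\<open>sum_Var_slice_powr_le\<close>): the increments of the slices add
  up to at most \<open>\<bar>f(x) - f(y)\<bar>\<close>, a sum of \<open>p\<close>-th powers is at most the \<open>p\<close>-th power of the sum when
  \<open>p \<ge> 1\<close>, and a lower limit is superadditive. Taking \<open>q\<close>-th roots gives the theorem with the
  constant \<open>8\<close>, a factor \<open>4\<close> coming from the dyadic decomposition and a factor \<open>2\<close> from the
  choice of \<open>s / 2\<close>.

  All slices of \<open>f\<close> are integrable even if \<open>f\<close> is not. This settles the case
  where the right-hand side is a product of \<open>\<infinity>\<close> and \<open>0\<close>: if \<open>C\<^sub>p Var f = 0\<close>, the
  weak estimate for the slices shows that every set \<open>{\<bar>f\<bar> \<ge> 2\<^sup>j\<^sup>+\<^sup>1}\<close> is a null set.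
\<close>

section \<open>Powers and lower limits of extended nonnegative reals\<close>

lemma epowr_ennreal [simp]: "0 \<le> x \<Longrightarrow> epowr (ennreal x) a = ennreal (x powr a)"
  by (simp add: epowr_def)

lemma epowr_top [simp]: "epowr top a = top"
  by (simp add: epowr_def)

lemma epowr_zero [simp]: "epowr 0 a = 0"
  by (simp add: epowr_def)

lemma epowr_mono:
  assumes "0 \<le> a" "x \<le> y"
  shows "epowr x a \<le> epowr y a"
proof (cases "y = top")
  case False
  with assms have "x \<noteq> top"
    by (auto simp: top_unique)
  with False assms show ?thesis
    by (auto simp: epowr_def intro!: powr_mono2 enn2real_mono ennreal_leI simp: less_top)
qed simp

lemma epowr_mult: "epowr (x * y) a = epowr x a * epowr y a"
  by (cases x; cases y)
     (auto simp: powr_mult ennreal_mult[symmetric] ennreal_mult_top ennreal_top_mult epowr_def enn2real_mult)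

lemma epowr_epowr: "epowr (epowr x a) b = epowr x (a * b)"
  by (cases x) (auto simp: powr_powr)

lemma epowr_one [simp]: "epowr x 1 = x"
  by (cases x) auto

text \<open>
  A monotone surjection between linear continua has no jumps; surjectivity comes from the inverse
  power.
\<close>

lemma continuous_on_epowr:
  assumes "0 < a"
  shows "continuous_on UNIV (\<lambda>x. epowr x a)"
proof (rule continuous_onI_mono)
  have "range (\<lambda>x. epowr x a) = UNIV"
    using assms by (intro surjI[where f = "\<lambda>x. epowr x (1 / a)"]) (simp add: epowr_epowr)
  then show "open (range (\<lambda>x. epowr x a))"
    by simp
qed (use assms in \<open>auto intro: epowr_mono\<close>)

lemma Liminf_epowr:
  assumes "0 < a" "F \<noteq> bot"
  shows "Liminf F (\<lambda>t. epowr (u t) a) = epowr (Liminf F u) a"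
  using assms
  by (intro Liminf_compose_continuous_mono continuous_on_epowr) (auto simp: mono_def epowr_mono)

text \<open>
  The lower limit is a supremum over a directed family of infima, and suprema of sums over
  directed families split.
\<close>

lemma Liminf_add_superadditive_ennreal:
  fixes u v :: "'a \<Rightarrow> ennreal"
  shows "Liminf F u + Liminf F v \<le> Liminf F (\<lambda>t. u t + v t)"
proof -
  have "Liminf F u + Liminf F v
      = (SUP P\<in>{P. eventually P F}. (INF t\<in>{t. P t}. u t) + (INF t\<in>{t. P t}. v t))"
    unfolding Liminf_def
  proof (rule SUP_add_directed_ennreal[symmetric])
    fix P Q assume "P \<in> {P. eventually P F}" "Q \<in> {P. eventually P F}"
    then show "\<exists>R\<in>{P. eventually P F}. (INF t\<in>{t. P t}. u t) + (INF t\<in>{t. Q t}. v t)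
        \<le> (INF t\<in>{t. R t}. u t) + (INF t\<in>{t. R t}. v t)"
      by (intro bexI[of _ "\<lambda>t. P t \<and> Q t"] add_mono INF_superset_mono) (auto intro: eventually_conj)
  qed
  also have "\<dots> \<le> Liminf F (\<lambda>t. u t + v t)"
    unfolding Liminf_def by (intro SUP_mono) (auto intro!: INF_greatest add_mono INF_lower)
  finally show ?thesis .
qed

lemma sum_Liminf_le_Liminf_sum_ennreal:
  fixes u :: "'i \<Rightarrow> 'a \<Rightarrow> ennreal"
  assumes "finite J"
  shows "(\<Sum>j\<in>J. Liminf F (u j)) \<le> Liminf F (\<lambda>t. \<Sum>j\<in>J. u j t)"
  using assms
proof induction
  case empty
  then show ?case by simp
next
  case (insert j J)
  have "Liminf F (u j) + (\<Sum>j\<in>J. Liminf F (u j)) \<le> Liminf F (u j) + Liminf F (\<lambda>t. \<Sum>j\<in>J. u j t)"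
    by (intro add_mono insert.IH order_refl)
  also have "\<dots> \<le> Liminf F (\<lambda>t. u j t + (\<Sum>j\<in>J. u j t))"
    by (rule Liminf_add_superadditive_ennreal)
  finally show ?case
    using insert.hyps by simp
qed

text \<open>
  With \<open>S\<close> the sum of the \<open>x\<^sub>j\<close>, every term satisfies \<open>x\<^sub>j\<^sup>p = x\<^sub>j x\<^sub>j\<^sup>p\<^sup>-\<^sup>1 \<le> x\<^sub>j S\<^sup>p\<^sup>-\<^sup>1\<close>.
\<close>

lemma sum_powr_le_powr_sum:
  fixes x :: "'i \<Rightarrow> real"
  assumes "1 \<le> p" "finite J" "\<And>j. j \<in> J \<Longrightarrow> 0 \<le> x j"
  shows "(\<Sum>j\<in>J. x j powr p) \<le> (\<Sum>j\<in>J. x j) powr p"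
proof -
  define S where "S = (\<Sum>j\<in>J. x j)"
  have S: "0 \<le> S"
    unfolding S_def by (intro sum_nonneg assms)
  have split: "y powr p = y * y powr (p - 1)" if "0 \<le> y" for y :: real
    using that by (cases "y = 0") (auto simp: powr_diff)
  have "(\<Sum>j\<in>J. x j powr p) \<le> (\<Sum>j\<in>J. x j * S powr (p - 1))"
  proof (intro sum_mono)
    fix j assume j: "j \<in> J"
    then have "x j \<le> S"
      unfolding S_def using assms by (intro member_le_sum) auto
    then show "x j powr p \<le> x j * S powr (p - 1)"
      using assms(1) assms(3)[OF j] by (auto simp: split intro!: mult_left_mono powr_mono2)
  qed
  also have "\<dots> = S powr p"
    using S by (simp add: split S_def sum_distrib_right)
  finally show ?thesis
    unfolding S_def .
qed

section \<open>Dyadic slices\<close>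

text \<open>
  For \<open>a \<ge> 0\<close> this is the length of the part of the interval from \<open>0\<close> to \<open>a\<close> that lies between the heights
  \<open>h\<close> and \<open>2 h\<close>, that is \<open>(a - h)\<^sub>+ \<and> h\<close>. Written as a difference of two minima, it telescopes when
  \<open>h\<close> is doubled.
\<close>

definition slice :: "real \<Rightarrow> real \<Rightarrow> real" where
  "slice h a = min a (2 * h) - min a h"

lemma slice_mono: "0 < h \<Longrightarrow> a \<le> b \<Longrightarrow> slice h a \<le> slice h b"
  by (auto simp: slice_def min_def)

lemma slice_nonneg: "0 < h \<Longrightarrow> 0 \<le> slice h a"
  by (auto simp: slice_def min_def)

lemma slice_le: "0 < h \<Longrightarrow> 0 \<le> a \<Longrightarrow> slice h a \<le> a"
  by (auto simp: slice_def min_def)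

lemma slice_le_height: "0 < h \<Longrightarrow> slice h a \<le> h"
  by (auto simp: slice_def min_def)

lemma slice_eq_height: "0 < h \<Longrightarrow> 2 * h \<le> a \<Longrightarrow> slice h a = h"
  by (auto simp: slice_def min_def)

lemma slice_eq_0: "0 < h \<Longrightarrow> a \<le> h \<Longrightarrow> slice h a = 0"
  by (auto simp: slice_def min_def)

abbreviation dyadic :: "int \<Rightarrow> real" where
  "dyadic j \<equiv> 2 powr of_int j"

lemma dyadic_Suc: "dyadic (j + 1) = 2 * dyadic j"
  by (simp add: powr_add)

text \<open>
  If all indices lie below \<open>m\<close>, the sum is even bounded by the increment of \<open>min \<cdot> (2\<^sup>m)\<close>: adding a new
  largest index \<open>n\<close> adds at most the telescoping step from \<open>2\<^sup>n\<close> to \<open>2\<^sup>n\<^sup>+\<^sup>1\<close>, and gaps between indices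
  only help.
\<close>

lemma sum_slice_diff_le:
  assumes "finite J" "a \<le> b"
  shows "(\<Sum>j\<in>J. slice (dyadic j) b - slice (dyadic j) a) \<le> b - a"
proof -
  have "(\<Sum>j\<in>J. slice (dyadic j) b - slice (dyadic j) a) \<le> min b (dyadic m) - min a (dyadic m)"
    if "\<forall>j\<in>J. j < m" for m
    using \<open>finite J\<close> that
  proof (induction J arbitrary: m rule: finite_linorder_max_induct)
    case empty
    then show ?case using \<open>a \<le> b\<close> by (auto simp: min_def)
  next
    case (insert n J)
    have "(\<Sum>j\<in>insert n J. slice (dyadic j) b - slice (dyadic j) a)
        \<le> (slice (dyadic n) b - slice (dyadic n) a) + (min b (dyadic n) - min a (dyadic n))"
      using insert by (subst sum.insert) auto
    also have "\<dots> = min b (dyadic (n + 1)) - min a (dyadic (n + 1))"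
      unfolding slice_def dyadic_Suc by simp
    also have "\<dots> \<le> min b (dyadic m) - min a (dyadic m)"
    proof -
      have "dyadic (n + 1) \<le> dyadic m"
        using insert.prems by (intro powr_mono) auto
      then show ?thesis
        using \<open>a \<le> b\<close> by (smt (verit) min_def)
    qed
    finally show ?case .
  qed
  moreover obtain m where "\<forall>j\<in>J. j < m"
  proof
    show "\<forall>j\<in>J. j < Max (insert 0 J) + 1"
      using \<open>finite J\<close> by (auto simp: zless_add1_eq le_less[symmetric] intro: Max_ge)
  qed
  ultimately have "(\<Sum>j\<in>J. slice (dyadic j) b - slice (dyadic j) a) \<le> min b (dyadic m) - min a (dyadic m)"
    by blast
  also have "\<dots> \<le> b - a"
    using \<open>a \<le> b\<close> by (auto simp: min_def)
  finally show ?thesis .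
qed

lemma sum_abs_slice_diff_le:
  assumes "finite J"
  shows "(\<Sum>j\<in>J. \<bar>slice (dyadic j) a - slice (dyadic j) b\<bar>) \<le> \<bar>a - b\<bar>"
proof (cases a b rule: linorder_le_cases)
  case le
  then have "(\<Sum>j\<in>J. \<bar>slice (dyadic j) a - slice (dyadic j) b\<bar>)
      = (\<Sum>j\<in>J. slice (dyadic j) b - slice (dyadic j) a)"
    by (intro sum.cong) (auto simp: slice_mono abs_minus_commute)
  with sum_slice_diff_le[OF assms le] le show ?thesis by simp
next
  case ge
  then have "(\<Sum>j\<in>J. \<bar>slice (dyadic j) a - slice (dyadic j) b\<bar>)
      = (\<Sum>j\<in>J. slice (dyadic j) a - slice (dyadic j) b)"
    by (intro sum.cong) (auto simp: slice_mono)
  with sum_slice_diff_le[OF assms ge] ge show ?thesis by simp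
qed

lemma dyadic_level_exists:
  assumes "0 < a"
  obtains j :: int where "2 * dyadic j \<le> a" "a < 4 * dyadic j"
proof
  let ?j = "\<lfloor>log 2 a\<rfloor> - 1"
  have "2 powr log 2 a = a"
    using assms by simp
  moreover have "2 powr (of_int ?j + 1) \<le> 2 powr log 2 a"
    by (intro powr_mono) auto
  moreover have "2 powr log 2 a < 2 powr (of_int ?j + 2)"
    by (intro powr_less_mono) linarith+
  ultimately show "2 * dyadic ?j \<le> a" "a < 4 * dyadic ?j"
    by (simp_all add: powr_add powr_diff)
qed

text \<open>
  A point with \<open>2 \<cdot> 2\<^sup>j \<le> \<bar>f x\<bar> < 4 \<cdot> 2\<^sup>j\<close> belongs to the level set with index \<open>j\<close>, whose summand
  alone already exceeds \<open>\<bar>f x\<bar>\<^sup>q\<close>. The integers are enumerated by \<open>int_decode\<close> in order to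
  interchange a countable sum with the integral.
\<close>

lemma nn_integral_powr_le_dyadic:
  assumes [measurable]: "f \<in> borel_measurable M" and "0 < q"
    and sums: "\<And>J. finite J \<Longrightarrow>
      (\<Sum>j\<in>J. ennreal ((4 * dyadic j) powr q)
        * emeasure M {x \<in> space M. 2 * dyadic j \<le> \<bar>f x\<bar>}) \<le> B"
  shows "(\<integral>\<^sup>+x. ennreal (\<bar>f x\<bar> powr q) \<partial>M) \<le> B"
proof -
  define L where "L j = {x \<in> space M. 2 * dyadic j \<le> \<bar>f x\<bar>}" for j :: int
  have L [measurable]: "L j \<in> sets M" for j
    unfolding L_def by measurable
  define h where "h j x = ennreal ((4 * dyadic j) powr q) * indicator (L j) x" for j x
  have h [measurable]: "h j \<in> borel_measurable M" for j
    unfolding h_def by measurable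
  have "(\<integral>\<^sup>+x. ennreal (\<bar>f x\<bar> powr q) \<partial>M) \<le> (\<integral>\<^sup>+x. (\<Sum>n. h (int_decode n) x) \<partial>M)"
  proof (intro nn_integral_mono)
    fix x assume x: "x \<in> space M"
    show "ennreal (\<bar>f x\<bar> powr q) \<le> (\<Sum>n. h (int_decode n) x)"
    proof (cases "f x = 0")
      case False
      then obtain j :: int where j: "2 * dyadic j \<le> \<bar>f x\<bar>" "\<bar>f x\<bar> < 4 * dyadic j"
        using dyadic_level_exists[of "\<bar>f x\<bar>"] by auto
      have "\<bar>f x\<bar> powr q \<le> (4 * dyadic j) powr q"
        using j \<open>0 < q\<close> by (intro powr_mono2) auto
      then have "ennreal (\<bar>f x\<bar> powr q) \<le> h j x"
        using j x by (auto simp: h_def L_def powr_powr intro: ennreal_leI)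
      also have "\<dots> = (\<Sum>n\<in>{int_encode j}. h (int_decode n) x)"
        by simp
      also have "\<dots> \<le> (\<Sum>n. h (int_decode n) x)"
        by (intro sum_le_suminf) auto
      finally show ?thesis .
    qed simp
  qed
  also have "\<dots> = (\<Sum>n. \<integral>\<^sup>+x. h (int_decode n) x \<partial>M)"
    by (intro nn_integral_suminf) measurable
  also have "\<dots> \<le> B"
  proof (intro suminf_le_const allI)
    fix N
    have "(\<Sum>n<N. \<integral>\<^sup>+x. h (int_decode n) x \<partial>M)
        = (\<Sum>n<N. ennreal ((4 * dyadic (int_decode n)) powr q) * emeasure M (L (int_decode n)))"
      unfolding h_def by (simp add: nn_integral_cmult_indicator)
    also have "\<dots> = (\<Sum>j\<in>int_decode ` {..<N}. ennreal ((4 * dyadic j) powr q) * emeasure M (L j))"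
      by (subst sum.reindex) (auto intro: inj_int_decode)
    also have "\<dots> \<le> B"
      unfolding L_def by (intro sums) auto
    finally show "(\<Sum>n<N. \<integral>\<^sup>+x. h (int_decode n) x \<partial>M) \<le> B" .
  qed auto
  finally show ?thesis .
qed

section \<open>Slices of p-integrable functions\<close>

lemma Lp_dominated:
  assumes "f \<in> Lp M p" "g \<in> borel_measurable M" "0 \<le> p" "\<And>x. x \<in> space M \<Longrightarrow> \<bar>g x\<bar> \<le> \<bar>f x\<bar>"
  shows "g \<in> Lp M p"
proof -
  note [measurable] = \<open>g \<in> borel_measurable M\<close>
  have "integrable M (\<lambda>x. \<bar>g x\<bar> powr p)"
  proof (rule Bochner_Integration.integrable_bound)
    show "integrable M (\<lambda>x. \<bar>f x\<bar> powr p)"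
      using assms(1) by (simp add: Lp_def)
  qed (use assms in \<open>auto intro!: powr_mono2\<close>)
  then show ?thesis
    using assms(2) by (simp add: Lp_def)
qed

lemma mem_Lp_1: "f \<in> Lp M 1 \<longleftrightarrow> integrable M f"
  unfolding Lp_def by (auto simp: integrable_abs_iff)

lemma Lp_norm_1: "Lp_norm M 1 f = (\<integral>\<^sup>+x. ennreal \<bar>f x\<bar> \<partial>M)"
  by (simp add: Lp_norm_def)

text \<open>
  The slice vanishes where \<open>\<bar>f\<bar> \<le> h\<close> and is at most \<open>h\<close> elsewhere, hence it is bounded by
  \<open>h (\<bar>f\<bar> / h)\<^sup>p\<close>.
\<close>

lemma integrable_slice:
  assumes "f \<in> Lp M p" "1 \<le> p" "0 < h"
  shows "integrable M (\<lambda>x. slice h \<bar>f x\<bar>)"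
proof (rule Bochner_Integration.integrable_bound)
  show "integrable M (\<lambda>x. h * (\<bar>f x\<bar> powr p * h powr - p))"
    using assms by (simp add: Lp_def)
  show "(\<lambda>x. slice h \<bar>f x\<bar>) \<in> borel_measurable M"
    using assms(1) unfolding slice_def Lp_def by auto
  show "AE x in M. norm (slice h \<bar>f x\<bar>) \<le> norm (h * (\<bar>f x\<bar> powr p * h powr - p))"
  proof (intro AE_I2)
    fix x
    show "norm (slice h \<bar>f x\<bar>) \<le> norm (h * (\<bar>f x\<bar> powr p * h powr - p))"
    proof (cases "\<bar>f x\<bar> \<le> h")
      case True
      then show ?thesis
        using assms(3) by (simp add: slice_eq_0)
    next
      case False
      then have "h powr p \<le> \<bar>f x\<bar> powr p"
        using assms by (intro powr_mono2) auto
      then have "1 \<le> \<bar>f x\<bar> powr p * h powr - p"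
        using assms(3) by (simp add: powr_minus field_simps)
      then have "h * 1 \<le> h * (\<bar>f x\<bar> powr p * h powr - p)"
        using assms(3) by (intro mult_left_mono) auto
      moreover have "\<bar>slice h \<bar>f x\<bar>\<bar> \<le> h"
        using assms(3) slice_le_height[of h "\<bar>f x\<bar>"] slice_nonneg[of h "\<bar>f x\<bar>"] by simp
      ultimately show ?thesis
        by (simp only: real_norm_def mult_1_right)
    qed
  qed
qed

section \<open>The energy of the slices\<close>

text \<open>
  The \<open>p\<close>-th power of \<open>heat_osc\<close>. Unlike \<open>heat_osc\<close> it is additive under sums of integrands, and so
  it is the quantity to compare for a function and its slices.
\<close>

definition heat_energy ::
  "'a measure \<Rightarrow> (real \<Rightarrow> 'a \<Rightarrow> 'a \<Rightarrow> real) \<Rightarrow> real \<Rightarrow> real \<Rightarrow> ('a \<Rightarrow> real) \<Rightarrow> ennreal" where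
  "heat_energy M k p t f =
     (\<integral>\<^sup>+y. (\<integral>\<^sup>+x. ennreal (k t y x * \<bar>f x - f y\<bar> powr p) \<partial>M) \<partial>M)"

lemma heat_osc_eq_heat_energy: "heat_osc M k p t f = epowr (heat_energy M k p t f) (1 / p)"
  by (simp add: heat_osc_def heat_energy_def)

lemma epowr_Var_eq_Liminf_heat_energy:
  assumes "0 < p"
  shows "epowr (Var M k p f) p
    = Liminf (at_right 0) (\<lambda>t. ennreal ((t powr - crit_alpha M k p) powr p) * heat_energy M k p t f)"
  unfolding Var_def using assms
  by (subst Liminf_epowr[symmetric])
     (simp_all add: heat_osc_eq_heat_energy epowr_mult epowr_epowr)

context dirichlet_space
begin

lemma kernel_measurable:
  assumes "0 < t"
  shows "(\<lambda>(x, y). k t x y) \<in> borel_measurable (M \<Otimes>\<^sub>M M)"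
  using kernel assms by (simp add: heat_kernel_def)

lemma kernel_nonneg: "\<lbrakk>0 < t; x \<in> space M; y \<in> space M\<rbrakk> \<Longrightarrow> 0 \<le> k t x y"
  using kernel by (simp add: heat_kernel_def)

lemma heat_energy_contraction:
  assumes "0 \<le> p" "0 < t"
    and "\<And>x y. \<lbrakk>x \<in> space M; y \<in> space M\<rbrakk> \<Longrightarrow> \<bar>g x - g y\<bar> \<le> \<bar>f x - f y\<bar>"
  shows "heat_energy M k p t g \<le> heat_energy M k p t f"
  unfolding heat_energy_def using assms
  by (intro nn_integral_mono ennreal_leI mult_left_mono powr_mono2 kernel_nonneg) auto

lemma sobolev_contraction:
  assumes "f \<in> sobolev M k p" "0 < p" "g \<in> borel_measurable M"
    and "\<And>x. x \<in> space M \<Longrightarrow> \<bar>g x\<bar> \<le> \<bar>f x\<bar>"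
    and "\<And>x y. \<lbrakk>x \<in> space M; y \<in> space M\<rbrakk> \<Longrightarrow> \<bar>g x - g y\<bar> \<le> \<bar>f x - f y\<bar>"
  shows "g \<in> sobolev M k p"
proof -
  let ?osc = "\<lambda>f t. ennreal (t powr - crit_alpha M k p) * heat_osc M k p t f"
  have f: "f \<in> Lp M p" "Limsup (at_right 0) (?osc f) < \<infinity>"
    using assms(1) by (auto simp: sobolev_def besov_def)
  have "Limsup (at_right 0) (?osc g) \<le> Limsup (at_right 0) (?osc f)"
  proof (intro Limsup_mono eventually_mono[OF eventually_at_right_less] mult_left_mono)
    fix t :: real assume "0 < t"
    then show "heat_osc M k p t g \<le> heat_osc M k p t f"
      unfolding heat_osc_eq_heat_energy using assms
      by (intro epowr_mono heat_energy_contraction) auto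
  qed auto
  then have "Limsup (at_right 0) (?osc g) < \<infinity>"
    using f(2) by (rule le_less_trans)
  then show ?thesis
    using Lp_dominated[OF f(1)] assms by (auto simp: sobolev_def besov_def)
qed

lemma sobolev_slice:
  assumes "f \<in> sobolev M k p" "0 < p"
  shows "(\<lambda>x. slice (dyadic j) \<bar>f x\<bar>) \<in> sobolev M k p"
proof (rule sobolev_contraction[OF assms])
  have [measurable]: "f \<in> borel_measurable M"
    using assms(1) by (simp add: sobolev_def besov_def Lp_def)
  show "(\<lambda>x. slice (dyadic j) \<bar>f x\<bar>) \<in> borel_measurable M"
    unfolding slice_def by measurable
  show "\<bar>slice (dyadic j) \<bar>f x\<bar>\<bar> \<le> \<bar>f x\<bar>" for x
    using slice_le[of "dyadic j" "\<bar>f x\<bar>"] slice_nonneg[of "dyadic j" "\<bar>f x\<bar>"] by simp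
  show "\<bar>slice (dyadic j) \<bar>f x\<bar> - slice (dyadic j) \<bar>f y\<bar>\<bar> \<le> \<bar>f x - f y\<bar>" for x y
    using sum_abs_slice_diff_le[of "{j}" "\<bar>f x\<bar>" "\<bar>f y\<bar>"] abs_triangle_ineq3[of "f x" "f y"] by simp
qed

text \<open>
  Both double integrals carry the same nonnegative weight \<open>k t y x\<close>, so it is enough to compare the
  integrands: \<open>\<Sum>\<^sub>j \<bar>f\<^sub>j x - f\<^sub>j y\<bar>\<^sup>p \<le> (\<Sum>\<^sub>j \<bar>f\<^sub>j x - f\<^sub>j y\<bar>)\<^sup>p \<le> \<bar>f x - f y\<bar>\<^sup>p\<close>.
\<close>

lemma sum_heat_energy_slice_le:
  assumes "1 \<le> p" "0 < t" "finite J" and [measurable]: "f \<in> borel_measurable M"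
  shows "(\<Sum>j\<in>J. heat_energy M k p t (\<lambda>x. slice (dyadic j) \<bar>f x\<bar>)) \<le> heat_energy M k p t f"
proof -
  note [measurable] = kernel_measurable[OF \<open>0 < t\<close>]
  let ?d = "\<lambda>j y x. \<bar>slice (dyadic j) \<bar>f x\<bar> - slice (dyadic j) \<bar>f y\<bar>\<bar>"
  let ?e = "\<lambda>j y x. ennreal (k t y x * ?d j y x powr p)"
  have e [measurable]: "(\<lambda>(y, x). ?e j y x) \<in> borel_measurable (M \<Otimes>\<^sub>M M)" for j
    unfolding slice_def by measurable
  have "(\<Sum>j\<in>J. heat_energy M k p t (\<lambda>x. slice (dyadic j) \<bar>f x\<bar>))
      = (\<integral>\<^sup>+y. (\<Sum>j\<in>J. \<integral>\<^sup>+x. ?e j y x \<partial>M) \<partial>M)"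
    unfolding heat_energy_def
    by (intro nn_integral_sum[symmetric] borel_measurable_nn_integral e)
  also have "\<dots> = (\<integral>\<^sup>+y. (\<integral>\<^sup>+x. (\<Sum>j\<in>J. ?e j y x) \<partial>M) \<partial>M)"
  proof (intro nn_integral_cong nn_integral_sum[symmetric])
    fix y j assume "y \<in> space M"
    then show "(\<lambda>x. ?e j y x) \<in> borel_measurable M"
      using measurable_Pair2[OF e] by simp
  qed
  also have "\<dots> \<le> heat_energy M k p t f"
    unfolding heat_energy_def
  proof (intro nn_integral_mono)
    fix x y assume xy: "x \<in> space M" "y \<in> space M"
    have k: "0 \<le> k t y x"
      using assms(2) xy by (intro kernel_nonneg)
    have "(\<Sum>j\<in>J. ?d j y x powr p) \<le> (\<Sum>j\<in>J. ?d j y x) powr p"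
      using assms by (intro sum_powr_le_powr_sum) auto
    also have "\<dots> \<le> \<bar>\<bar>f x\<bar> - \<bar>f y\<bar>\<bar> powr p"
      using assms by (intro powr_mono2 sum_abs_slice_diff_le sum_nonneg) auto
    also have "\<dots> \<le> \<bar>f x - f y\<bar> powr p"
      using assms by (intro powr_mono2) auto
    finally have "k t y x * (\<Sum>j\<in>J. ?d j y x powr p) \<le> k t y x * \<bar>f x - f y\<bar> powr p"
      using k by (rule mult_left_mono)
    then show "(\<Sum>j\<in>J. ?e j y x) \<le> ennreal (k t y x * \<bar>f x - f y\<bar> powr p)"
      using k by (simp add: sum_ennreal sum_distrib_left ennreal_leI)
  qed
  finally show ?thesis .
qed

text \<open>
  The decisive property of the variation: the energies of all slices fit together into the
  energy of \<open>f\<close>, with constant \<open>1\<close>. The inequality holds at each time \<open>t\<close>, and it survives the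
  passage to the lower limit because the sum stands on the smaller side.
\<close>

lemma sum_Var_slice_powr_le:
  assumes "1 \<le> p" "finite J" "f \<in> borel_measurable M"
  shows "(\<Sum>j\<in>J. epowr (Var M k p (\<lambda>x. slice (dyadic j) \<bar>f x\<bar>)) p) \<le> epowr (Var M k p f) p"
proof -
  let ?w = "\<lambda>t. ennreal ((t powr - crit_alpha M k p) powr p)"
  let ?E = "\<lambda>t j. heat_energy M k p t (\<lambda>x. slice (dyadic j) \<bar>f x\<bar>)"
  have "(\<Sum>j\<in>J. epowr (Var M k p (\<lambda>x. slice (dyadic j) \<bar>f x\<bar>)) p)
      = (\<Sum>j\<in>J. Liminf (at_right 0) (\<lambda>t. ?w t * ?E t j))"
    using assms by (simp add: epowr_Var_eq_Liminf_heat_energy)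
  also have "\<dots> \<le> Liminf (at_right 0) (\<lambda>t. \<Sum>j\<in>J. ?w t * ?E t j)"
    using assms(2) by (rule sum_Liminf_le_Liminf_sum_ennreal)
  also have "\<dots> \<le> Liminf (at_right 0) (\<lambda>t. ?w t * heat_energy M k p t f)"
  proof (intro Liminf_mono eventually_mono[OF eventually_at_right_less])
    fix t :: real assume "0 < t"
    then show "(\<Sum>j\<in>J. ?w t * ?E t j) \<le> ?w t * heat_energy M k p t f"
      unfolding sum_distrib_left[symmetric] using assms
      by (intro mult_left_mono sum_heat_energy_slice_le) auto
  qed
  also have "\<dots> = epowr (Var M k p f) p"
    using assms by (simp add: epowr_Var_eq_Liminf_heat_energy)
  finally show ?thesis .
qed

end

section \<open>Weak-type estimate\<close>

locale ultracontractive_PPI_space = dirichlet_space M E F P k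
  for M :: "'a measure" and E F P k +
  fixes p \<beta> C_h C_p :: real
  assumes p: "1 \<le> p" and \<beta>: "0 < \<beta>" and C_h: "0 < C_h" and C_p: "0 \<le> C_p"
    and crit: "0 < crit_exp M k p" "crit_exp M k p < \<infinity>"
    and kernel_bound: "\<And>t. 0 < t \<Longrightarrow> AE (x, y) in M \<Otimes>\<^sub>M M. k t x y \<le> C_h * t powr - \<beta>"
    and PPI: "PPI M P k p C_p"
begin

abbreviation \<alpha> :: real where
  "\<alpha> \<equiv> crit_alpha M k p"

abbreviation q :: real where
  "q \<equiv> p * (1 + \<alpha> / \<beta>)"

lemma \<alpha>_pos: "0 < \<alpha>"
  using crit by (cases "crit_exp M k p") (auto simp: crit_alpha_def)

lemma heat_semigroup_ultracontractive:
  assumes "0 < t" "integrable M g"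
  shows "AE x in M. \<bar>P t g x\<bar> \<le> C_h * t powr - \<beta> * (LINT y|M. \<bar>g y\<bar>)"
proof -
  interpret pair_sigma_finite M M ..
  have "AE x in M. AE y in M. k t x y \<le> C_h * t powr - \<beta>"
    using AE_pair[OF kernel_bound[OF assms(1)]] by simp
  moreover have "AE x in M. integrable M (\<lambda>y. k t x y * g y) \<and> P t g x = (LINT y|M. k t x y * g y)"
  proof -
    have "g \<in> (\<Union>r\<in>{1..}. Lp M r)"
      using assms(2) mem_Lp_1[of g M] by force
    then show ?thesis
      using kernel assms(1) unfolding heat_kernel_def by blast
  qed
  ultimately show ?thesis
    using AE_space
  proof eventually_elim
    case (elim x)
    have "\<bar>P t g x\<bar> \<le> (LINT y|M. \<bar>k t x y * g y\<bar>)"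
      using elim by simp
    also have "\<dots> \<le> (LINT y|M. C_h * t powr - \<beta> * \<bar>g y\<bar>)"
    proof (rule integral_mono_AE)
      show "AE y in M. \<bar>k t x y * g y\<bar> \<le> C_h * t powr - \<beta> * \<bar>g y\<bar>"
        using elim(1) AE_space
      proof eventually_elim
        case (elim y)
        then have "0 \<le> k t x y"
          using assms(1) \<open>x \<in> space M\<close> by (intro kernel_nonneg)
        with elim show ?case
          by (auto simp: abs_mult intro!: mult_right_mono)
      qed
    qed (use elim assms in auto)
    finally show ?case
      by simp
  qed
qed

text \<open>
  The bound \<open>A\<close> for the norm in \<open>L\<^sup>1\<close> is kept separate from the norm, since the time \<open>t\<close> in the
  proof exists only for a strictly positive bound.
\<close>

lemma level_set_estimate:
  assumes g: "g \<in> sobolev M k p" "integrable M g"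
    and A: "(LINT x|M. \<bar>g x\<bar>) \<le> A" "0 < A" and s: "0 < s"
  shows "ennreal (s powr q) * emeasure M {x \<in> space M. s \<le> \<bar>g x\<bar>}
    \<le> ennreal (2 powr q * (C_h * A) powr (\<alpha> * p / \<beta>)) * epowr (ennreal C_p * Var M k p g) p"
proof -
  \<comment> \<open>the time at which the bound for \<open>P t g\<close> has decayed to half of the level \<open>s\<close>\<close>
  define t where "t = (2 * C_h * A / s) powr (1 / \<beta>)"
  have t: "0 < t"
    using C_h A s by (simp add: t_def)
  have decay: "C_h * t powr - \<beta> * A = s / 2"
    using C_h A s \<beta> by (simp add: t_def powr_powr powr_minus field_simps)
  define D where "D = epowr (ennreal C_p * Var M k p g) p"
  define L where "L = {x \<in> space M. s \<le> \<bar>g x\<bar>}"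
  have gLp: "g \<in> Lp M p"
    using g(1) by (simp add: sobolev_def besov_def)
  then have "P t g \<in> Lp M p"
    using extended p t by (auto simp: Lp_extended_def)
  then have [measurable]: "P t g \<in> borel_measurable M" "g \<in> borel_measurable M"
    using gLp by (auto simp: Lp_def)
  have [measurable]: "L \<in> sets M"
    unfolding L_def by measurable
  have "ennreal ((s / 2) powr p) * emeasure M L = (\<integral>\<^sup>+x. ennreal ((s / 2) powr p) * indicator L x \<partial>M)"
    by (simp add: nn_integral_cmult_indicator)
  also have "\<dots> \<le> (\<integral>\<^sup>+x. ennreal (\<bar>P t g x - g x\<bar> powr p) \<partial>M)"
  proof (rule nn_integral_mono_AE)
    show "AE x in M. ennreal ((s / 2) powr p) * indicator L x \<le> ennreal (\<bar>P t g x - g x\<bar> powr p)"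
      using heat_semigroup_ultracontractive[OF t g(2)]
    proof eventually_elim
      case (elim x)
      also have "C_h * t powr - \<beta> * (LINT y|M. \<bar>g y\<bar>) \<le> s / 2"
        unfolding decay[symmetric] using A C_h by (intro mult_left_mono) auto
      finally have "s / 2 \<le> \<bar>P t g x - g x\<bar>" if "x \<in> L"
        using that abs_triangle_ineq2[of "g x" "P t g x"] by (simp add: L_def abs_minus_commute)
      then have "(s / 2) powr p \<le> \<bar>P t g x - g x\<bar> powr p" if "x \<in> L"
        using that s p by (intro powr_mono2) auto
      then show ?case
        by (auto simp: indicator_def intro: ennreal_leI)
    qed
  qed
  also have "\<dots> = epowr (Lp_norm M p (\<lambda>x. P t g x - g x)) p"
    using p by (simp add: Lp_norm_def epowr_epowr)
  also have "\<dots> \<le> epowr (ennreal (C_p * t powr \<alpha>) * Var M k p g) p"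
    using PPI g(1) t p by (intro epowr_mono) (auto simp: PPI_def)
  also have "\<dots> = ennreal (t powr (\<alpha> * p)) * D"
    using C_p by (simp add: D_def ennreal_mult epowr_mult powr_powr mult_ac)
  finally have weak: "ennreal ((s / 2) powr p) * emeasure M L \<le> ennreal (t powr (\<alpha> * p)) * D" .
  have q: "q = p + \<alpha> * p / \<beta>"
    by (simp add: algebra_simps)
  have "ennreal (s powr q) * emeasure M L
      = ennreal (2 powr p * s powr (\<alpha> * p / \<beta>)) * (ennreal ((s / 2) powr p) * emeasure M L)"
    using s unfolding mult.assoc[symmetric]
    by (simp add: q powr_add powr_divide ennreal_mult[symmetric] mult_ac)
  also have "\<dots> \<le> ennreal (2 powr p * s powr (\<alpha> * p / \<beta>)) * (ennreal (t powr (\<alpha> * p)) * D)"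
    using weak by (rule mult_left_mono) simp
  also have "\<dots> = ennreal (2 powr q * (C_h * A) powr (\<alpha> * p / \<beta>)) * D"
  proof -
    have "t powr (\<alpha> * p) = (2 * C_h * A / s) powr (\<alpha> * p / \<beta>)"
      by (simp add: t_def powr_powr)
    also have "\<dots> = 2 powr (\<alpha> * p / \<beta>) * (C_h * A) powr (\<alpha> * p / \<beta>) / s powr (\<alpha> * p / \<beta>)"
      using s C_h A by (simp add: powr_divide powr_mult)
    finally have "2 powr p * s powr (\<alpha> * p / \<beta>) * t powr (\<alpha> * p)
        = 2 powr q * (C_h * A) powr (\<alpha> * p / \<beta>)"
      using s by (simp add: q powr_add)
    then show ?thesis
      unfolding mult.assoc[symmetric] by (simp add: ennreal_mult[symmetric])
  qed
  finally show ?thesis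
    by (simp add: L_def D_def)
qed

section \<open>From weak to strong type\<close>

text \<open>
  The slice \<open>g\<close> takes its maximal value \<open>2\<^sup>j\<close> wherever \<open>\<bar>f\<bar> \<ge> 2 \<cdot> 2\<^sup>j\<close>, so the level set of \<open>f\<close> is
  contained in a level set of \<open>g\<close>; the variation of \<open>g\<close>, and not that of \<open>f\<close>, appears on the right.
\<close>

lemma dyadic_level_estimate:
  fixes f :: "'a \<Rightarrow> real" and j :: int
  defines "g \<equiv> \<lambda>x. slice (dyadic j) \<bar>f x\<bar>"
  assumes f: "f \<in> sobolev M k p" and A: "(LINT x|M. \<bar>g x\<bar>) \<le> A" "0 < A"
  shows "ennreal ((4 * dyadic j) powr q) * emeasure M {x \<in> space M. 2 * dyadic j \<le> \<bar>f x\<bar>}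
    \<le> ennreal (8 powr q * (C_h * A) powr (\<alpha> * p / \<beta>)) * epowr (ennreal C_p * Var M k p g) p"
proof -
  have g: "g \<in> sobolev M k p"
    using f p unfolding g_def by (intro sobolev_slice) auto
  then have [measurable]: "g \<in> borel_measurable M"
    by (simp add: sobolev_def besov_def Lp_def)
  have gi: "integrable M g"
    unfolding g_def using f p by (intro integrable_slice) (auto simp: sobolev_def besov_def)
  have "ennreal ((4 * dyadic j) powr q) * emeasure M {x \<in> space M. 2 * dyadic j \<le> \<bar>f x\<bar>}
      \<le> ennreal ((4 * dyadic j) powr q) * emeasure M {x \<in> space M. dyadic j \<le> \<bar>g x\<bar>}"
  proof (intro mult_left_mono emeasure_mono)
    show "{x \<in> space M. 2 * dyadic j \<le> \<bar>f x\<bar>} \<subseteq> {x \<in> space M. dyadic j \<le> \<bar>g x\<bar>}"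
    proof safe
      fix x assume "2 * dyadic j \<le> \<bar>f x\<bar>"
      then have "g x = dyadic j"
        unfolding g_def by (intro slice_eq_height) simp
      then show "dyadic j \<le> \<bar>g x\<bar>"
        by simp
    qed
  qed measurable
  also have "\<dots> = ennreal (4 powr q) * (ennreal (dyadic j powr q) * emeasure M {x \<in> space M. dyadic j \<le> \<bar>g x\<bar>})"
    by (simp only: powr_mult ennreal_mult powr_ge_zero mult.assoc)
  also have "\<dots> \<le> ennreal (4 powr q)
      * (ennreal (2 powr q * (C_h * A) powr (\<alpha> * p / \<beta>)) * epowr (ennreal C_p * Var M k p g) p)"
    using g gi A by (intro mult_left_mono level_set_estimate) auto
  also have "\<dots> = ennreal (8 powr q * (C_h * A) powr (\<alpha> * p / \<beta>)) * epowr (ennreal C_p * Var M k p g) p"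
  proof -
    have "(8::real) powr q = 4 powr q * 2 powr q"
      using powr_mult[of 4 2 q] by simp
    then show ?thesis
      by (simp only: ennreal_mult powr_ge_zero mult_nonneg_nonneg mult.assoc)
  qed
  finally show ?thesis .
qed

lemma nn_integral_powr_q_le:
  assumes f: "f \<in> sobolev M k p" and A: "\<And>j. (LINT x|M. \<bar>slice (dyadic j) \<bar>f x\<bar>\<bar>) \<le> A" "0 < A"
  shows "(\<integral>\<^sup>+x. ennreal (\<bar>f x\<bar> powr q) \<partial>M)
    \<le> ennreal (8 powr q * (C_h * A) powr (\<alpha> * p / \<beta>)) * epowr (ennreal C_p * Var M k p f) p"
proof (rule nn_integral_powr_le_dyadic)
  show fm: "f \<in> borel_measurable M"
    using f by (simp add: sobolev_def besov_def Lp_def)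
  show "0 < q"
    using p \<beta> \<alpha>_pos by (simp add: add_pos_pos)
  fix J :: "int set" assume J: "finite J"
  let ?c = "ennreal (8 powr q * (C_h * A) powr (\<alpha> * p / \<beta>))"
  have "(\<Sum>j\<in>J. ennreal ((4 * dyadic j) powr q) * emeasure M {x \<in> space M. 2 * dyadic j \<le> \<bar>f x\<bar>})
      \<le> (\<Sum>j\<in>J. ?c * epowr (ennreal C_p * Var M k p (\<lambda>x. slice (dyadic j) \<bar>f x\<bar>)) p)"
    by (intro sum_mono dyadic_level_estimate f A)
  also have "\<dots> = ?c * (epowr (ennreal C_p) p * (\<Sum>j\<in>J. epowr (Var M k p (\<lambda>x. slice (dyadic j) \<bar>f x\<bar>)) p))"
    by (simp add: epowr_mult sum_distrib_left)
  also have "\<dots> \<le> ?c * (epowr (ennreal C_p) p * epowr (Var M k p f) p)"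
    using p J fm by (intro mult_left_mono sum_Var_slice_powr_le) auto
  finally show "(\<Sum>j\<in>J. ennreal ((4 * dyadic j) powr q) * emeasure M {x \<in> space M. 2 * dyadic j \<le> \<bar>f x\<bar>})
      \<le> ?c * epowr (ennreal C_p * Var M k p f) p"
    by (simp add: epowr_mult)
qed

text \<open>
  Here \<open>f\<close> need not be integrable, so each slice is estimated with a bound \<open>A\<close> of its own; the
  variation of every slice is at most that of \<open>f\<close>.
\<close>

lemma nn_integral_powr_q_eq_0:
  assumes f: "f \<in> sobolev M k p" and zero: "ennreal C_p * Var M k p f = 0"
  shows "(\<integral>\<^sup>+x. ennreal (\<bar>f x\<bar> powr q) \<partial>M) = 0"
proof -
  have fm: "f \<in> borel_measurable M"
    using f by (simp add: sobolev_def besov_def Lp_def)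
  have "(\<integral>\<^sup>+x. ennreal (\<bar>f x\<bar> powr q) \<partial>M) \<le> 0"
  proof (rule nn_integral_powr_le_dyadic[OF fm])
    show "0 < q"
      using p \<beta> \<alpha>_pos by (simp add: add_pos_pos)
    fix J :: "int set"
    have "ennreal ((4 * dyadic j) powr q) * emeasure M {x \<in> space M. 2 * dyadic j \<le> \<bar>f x\<bar>} = 0" for j
    proof -
      let ?g = "\<lambda>x. slice (dyadic j) \<bar>f x\<bar>"
      have "epowr (ennreal C_p * Var M k p ?g) p \<le> epowr (ennreal C_p) p * epowr (Var M k p f) p"
        unfolding epowr_mult using sum_Var_slice_powr_le[of p "{j}" f] p fm
        by (intro mult_left_mono) auto
      also have "\<dots> = 0"
        unfolding epowr_mult[symmetric] zero by simp
      finally show ?thesis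
        \<comment> \<open>the summand \<open>1\<close> keeps the bound positive when the slice vanishes\<close>
        using dyadic_level_estimate[OF f, of j "(LINT x|M. \<bar>?g x\<bar>) + 1"]
        by (simp add: add_nonneg_pos)
    qed
    then show "(\<Sum>j\<in>J. ennreal ((4 * dyadic j) powr q)
        * emeasure M {x \<in> space M. 2 * dyadic j \<le> \<bar>f x\<bar>}) \<le> 0"
      by simp
  qed
  then show ?thesis
    by simp
qed

text \<open>
  The \<open>q\<close>-th root of \<open>nn_integral_powr_q_le\<close>, used with \<open>A = \<parallel>f\<parallel>\<^sub>1\<close>. The values \<open>\<parallel>f\<parallel>\<^sub>1 = \<infinity>\<close> and
  \<open>\<parallel>f\<parallel>\<^sub>1 = 0\<close> are treated apart: in the first case the right-hand side is \<open>\<infinity>\<close> unless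
  \<open>C\<^sub>p Var f = 0\<close>, and in both exceptional cases \<open>f\<close> vanishes almost everywhere.
\<close>

lemma Gagliardo_Nirenberg:
  assumes f: "f \<in> sobolev M k p"
  shows "Lp_norm M q f
    \<le> ennreal (8 * C_p powr (\<beta> / (\<beta> + \<alpha>)) * C_h powr (\<alpha> / (\<beta> + \<alpha>)))
      * epowr (Var M k p f) (\<beta> / (\<beta> + \<alpha>)) * epowr (Lp_norm M 1 f) (\<alpha> / (\<beta> + \<alpha>))"
    (is "_ \<le> ?rhs")
proof -
  let ?I = "\<integral>\<^sup>+x. ennreal (\<bar>f x\<bar> powr q) \<partial>M"
  have [measurable]: "f \<in> borel_measurable M"
    using f by (simp add: sobolev_def besov_def Lp_def)
  have q_pos: "0 < q"
    using p \<beta> \<alpha>_pos by (simp add: add_pos_pos)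
  have q1: "q * (1 / q) = 1"
    using right_inverse[OF less_imp_neq[OF q_pos, symmetric]] by (simp only: divide_inverse mult_1_left)
  have e1: "p * (1 / q) = \<beta> / (\<beta> + \<alpha>)" and e2: "\<alpha> * p / \<beta> * (1 / q) = \<alpha> / (\<beta> + \<alpha>)"
  proof -
    have q: "q = p * (\<beta> + \<alpha>) / \<beta>"
      using \<beta> by (simp add: field_simps)
    show "p * (1 / q) = \<beta> / (\<beta> + \<alpha>)" "\<alpha> * p / \<beta> * (1 / q) = \<alpha> / (\<beta> + \<alpha>)"
      unfolding q using p \<beta> by auto
  qed
  have trivial: "Lp_norm M q f \<le> ?rhs" if "?I = 0"
    using that by (simp add: Lp_norm_def)
  show ?thesis
  proof (cases "Lp_norm M 1 f = \<infinity>")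
    case True
    show ?thesis
    proof (cases "ennreal C_p * Var M k p f = 0")
      case True
      then show ?thesis
        by (intro trivial nn_integral_powr_q_eq_0 f)
    next
      case False
      then have "0 < C_p" "Var M k p f \<noteq> 0"
        using C_p by auto
      moreover have "epowr (Var M k p f) (\<beta> / (\<beta> + \<alpha>)) \<noteq> 0"
        using \<open>Var M k p f \<noteq> 0\<close> by (cases "Var M k p f") auto
      ultimately have "?rhs = top"
        using \<open>Lp_norm M 1 f = \<infinity>\<close> C_h by (auto simp: ennreal_mult_top ennreal_mult_eq_top_iff)
      then show ?thesis
        by (simp only: top_greatest)
    qed
  next
    case False
    then obtain A where A: "0 \<le> A" "Lp_norm M 1 f = ennreal A"
      by (cases "Lp_norm M 1 f") auto
    show ?thesis
    proof (cases "A = 0")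
      case True
      then have "AE x in M. f x = 0"
        using A by (simp add: Lp_norm_1 nn_integral_0_iff_AE)
      then have "?I = 0"
        using q_pos by (subst nn_integral_0_iff_AE) auto
      then show ?thesis
        by (rule trivial)
    next
      case False
      with A have A_pos: "0 < A"
        by simp
      have L1: "(LINT x|M. \<bar>slice (dyadic j) \<bar>f x\<bar>\<bar>) \<le> A" for j
      proof -
        have fi: "integrable M f"
          using A by (intro integrableI_bounded) (auto simp: Lp_norm_1)
        have "(LINT x|M. \<bar>slice (dyadic j) \<bar>f x\<bar>\<bar>) \<le> (LINT x|M. \<bar>f x\<bar>)"
        proof (rule integral_mono)
          show "integrable M (\<lambda>x. \<bar>slice (dyadic j) \<bar>f x\<bar>\<bar>)"
            using f p by (intro integrable_abs integrable_slice) (auto simp: sobolev_def besov_def)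
          show "\<bar>slice (dyadic j) \<bar>f x\<bar>\<bar> \<le> \<bar>f x\<bar>" for x
            using slice_le[of "dyadic j" "\<bar>f x\<bar>"] slice_nonneg[of "dyadic j" "\<bar>f x\<bar>"] by simp
        qed (use fi in simp)
        also have "ennreal (LINT x|M. \<bar>f x\<bar>) = ennreal A"
          using fi A by (subst nn_integral_eq_integral[symmetric]) (auto simp: Lp_norm_1)
        then have "(LINT x|M. \<bar>f x\<bar>) = A"
          using A by (simp add: ennreal_inj)
        finally show ?thesis .
      qed
      have "Lp_norm M q f = epowr ?I (1 / q)"
        by (simp add: Lp_norm_def)
      also have "\<dots> \<le> epowr (ennreal (8 powr q * (C_h * A) powr (\<alpha> * p / \<beta>))
          * epowr (ennreal C_p * Var M k p f) p) (1 / q)"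
        using q_pos f L1 A_pos by (intro epowr_mono nn_integral_powr_q_le) auto
      also have "\<dots> = ennreal (8 * (C_h * A) powr (\<alpha> / (\<beta> + \<alpha>)))
          * epowr (ennreal C_p * Var M k p f) (\<beta> / (\<beta> + \<alpha>))"
      proof -
        have "(8 powr q * (C_h * A) powr (\<alpha> * p / \<beta>)) powr (1 / q) = 8 * (C_h * A) powr (\<alpha> / (\<beta> + \<alpha>))"
          unfolding powr_mult powr_powr e2 q1 by simp
        then show ?thesis
          unfolding epowr_mult epowr_epowr e1 by simp
      qed
      also have "\<dots> = ?rhs"
        using C_p C_h A by (simp add: epowr_mult powr_mult ennreal_mult mult_ac)
      finally show ?thesis .
    qed
  qed
qed

end

theorem theorem4p1:
  fixes p :: real
  assumes "1 \<le> p"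
  shows "\<exists>c>0. \<forall>(M :: 'a measure) E F P k C_h \<beta> C_p.
    dirichlet_space M E F P k \<longrightarrow>
    0 < crit_exp M k p \<longrightarrow> crit_exp M k p < \<infinity> \<longrightarrow>
    0 < C_h \<longrightarrow> 0 < \<beta> \<longrightarrow>
    (\<forall>t>0. AE (x, y) in M \<Otimes>\<^sub>M M. k t x y \<le> C_h * t powr - \<beta>) \<longrightarrow>
    0 \<le> C_p \<longrightarrow> PPI M P k p C_p \<longrightarrow>
    (\<forall>f\<in>sobolev M k p.
      let \<alpha> = crit_alpha M k p;
          q = p * (1 + \<alpha> / \<beta>)
      in Lp_norm M q f
           \<le> ennreal (c * C_p powr (\<beta> / (\<beta> + \<alpha>)) * C_h powr (\<alpha> / (\<beta> + \<alpha>)))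
               * epowr (Var M k p f) (\<beta> / (\<beta> + \<alpha>))
               * epowr (Lp_norm M 1 f) (\<alpha> / (\<beta> + \<alpha>)))"
proof (intro exI[of _ 8] conjI allI impI ballI)
  fix M :: "'a measure" and E F P k C_h \<beta> C_p f
  assume "dirichlet_space M E F P k" "0 < crit_exp M k p" "crit_exp M k p < \<infinity>" "0 < C_h" "0 < \<beta>"
    "\<forall>t>0. AE (x, y) in M \<Otimes>\<^sub>M M. k t x y \<le> C_h * t powr - \<beta>" "0 \<le> C_p" "PPI M P k p C_p"
  with assms interpret ultracontractive_PPI_space M E F P k p \<beta> C_h C_p
    by (simp add: ultracontractive_PPI_space_def ultracontractive_PPI_space_axioms_def)
  assume "f \<in> sobolev M k p"
  then show "let \<alpha> = crit_alpha M k p; q = p * (1 + \<alpha> / \<beta>)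
      in Lp_norm M q f
           \<le> ennreal (8 * C_p powr (\<beta> / (\<beta> + \<alpha>)) * C_h powr (\<alpha> / (\<beta> + \<alpha>)))
               * epowr (Var M k p f) (\<beta> / (\<beta> + \<alpha>))
               * epowr (Lp_norm M 1 f) (\<alpha> / (\<beta> + \<alpha>))"
    unfolding Let_def by (rule Gagliardo_Nirenberg)
qed simp

end
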